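(* For every integer $q \geq 2$ there exist positive integers $n, m$ and an (irreducible) $q$-sport assignment problem $A \in \{0,1\}^{n\times m}$ such that no solution $X$ of $A$ is both efficient and strongly envy-free; and hence, for this $A$, no solution $X$ is both fair and strongly envy-free.
   Context: Fix an integer $q\ge 2$. There are $n$ players, indexed by $i\in\{1,\ldots,n\}$, and $m$ days, indexed by $k\in\{1,\ldots,m\}$. An (irreducible) $q$-sport assignment problem is a binary matrix $A=(a_{ik})\in\{0,1\}^{n\times m}$, where $a_{ik}=1$ means that player $i$ is available on day $k$, satisfying (1) $\sum_{k=1}^m a_{ik}\ge 1$ for every $i\in\{1,\ldots,n\}$, and (2) $\sum_{i=1}^n a_{ik}\ge q$ for every $k\in\{1,\ldots,m\}$. A solution (also called an assignment) of $A$ is a binary matrix $X=(x_{ik})\in\{0,1\}^{n\times m}$, where $x_{ik}=1$ means that player $i$ plays on day $k$, such that (3) for all $i,k$: $a_{ik}=0$ implies $x_{ik}=0$, and (4) for every $k$: $\sum_{i=1}^n x_{ik}\equiv 0 \pmod q$. Properties of a solution $X$ of $A$: - Efficient: there is no solution $X'$ of $A$ with $\sum_{i}\sum_{k} x'_{ik}>\sum_{i}\sum_{k} x_{ik}$. - Fair: for an integer $p$, let $G_p(X)$ be the number of players $i$ with $\sum_k x_{ik}\ge p$. A solution $X$ is fairer than a solution $X'$ if there is an integer $p$ with $G_p(X)>G_p(X')$ and $G_{p'}(X)=G_{p'}(X')$ for all integers $p'<p$. A solution $X$ of $A$ is fair if no solution of $A$ is fairer than $X$. - Strongly envy-free: for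 any two players $i,j$ with $\sum_k a_{ik}>\sum_k a_{jk}$, one has $\sum_k x_{ik}\ge\sum_k x_{jk}$. *)

theory Defs
  imports "HOL-Number_Theory.Cong" "Jordan_Normal_Form.Matrix"
begin

(* Matrices are indexed from 0: player i (paper: 1 <= i <= n) is row i < n, and
   day k (paper: 1 <= k <= m) is column k < m. *)

definition binary_mat :: "nat \<Rightarrow> nat \<Rightarrow> nat mat \<Rightarrow> bool" where
  "binary_mat n m A \<longleftrightarrow> A \<in> carrier_mat n m \<and> elements_mat A \<subseteq> {0, 1}"

definition sport_problem :: "nat \<Rightarrow> nat \<Rightarrow> nat \<Rightarrow> nat mat \<Rightarrow> bool" where
  "sport_problem q n m A \<longleftrightarrow>
     binary_mat n m A \<and>
     (\<forall>i<n. (\<Sum>k<m. A $$ (i, k)) \<ge> 1) \<and>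
     (\<forall>k<m. (\<Sum>i<n. A $$ (i, k)) \<ge> q)"

definition solution :: "nat \<Rightarrow> nat \<Rightarrow> nat \<Rightarrow> nat mat \<Rightarrow> nat mat \<Rightarrow> bool" where
  "solution q n m A X \<longleftrightarrow>
     binary_mat n m X \<and>
     (\<forall>i<n. \<forall>k<m. A $$ (i, k) = 0 \<longrightarrow> X $$ (i, k) = 0) \<and>
     (\<forall>k<m. [(\<Sum>i<n. X $$ (i, k)) = 0] (mod q))"

definition efficient :: "nat \<Rightarrow> nat \<Rightarrow> nat \<Rightarrow> nat mat \<Rightarrow> nat mat \<Rightarrow> bool" where
  "efficient q n m A X \<longleftrightarrow>
     solution q n m A X \<and>
     \<not> (\<exists>X'. solution q n m A X' \<and>
             (\<Sum>i<n. \<Sum>k<m. X' $$ (i, k)) > (\<Sum>i<n. \<Sum>k<m. X $$ (i, k)))"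

definition num_playing_at_least :: "nat \<Rightarrow> nat \<Rightarrow> int \<Rightarrow> nat mat \<Rightarrow> nat" where
  "num_playing_at_least n m p X = card {i. i < n \<and> int (\<Sum>k<m. X $$ (i, k)) \<ge> p}"

definition fairer :: "nat \<Rightarrow> nat \<Rightarrow> nat mat \<Rightarrow> nat mat \<Rightarrow> bool" where
  "fairer n m X X' \<longleftrightarrow>
     (\<exists>p. num_playing_at_least n m p X > num_playing_at_least n m p X' \<and>
          (\<forall>p'<p. num_playing_at_least n m p' X = num_playing_at_least n m p' X'))"

definition fair :: "nat \<Rightarrow> nat \<Rightarrow> nat \<Rightarrow> nat mat \<Rightarrow> nat mat \<Rightarrow> bool" where
  "fair q n m A X \<longleftrightarrow>
     solution q n m A X \<and> \<not> (\<exists>X'. solution q n m A X' \<and> fairer n m X' X)"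

definition strongly_envy_free :: "nat \<Rightarrow> nat \<Rightarrow> nat mat \<Rightarrow> nat mat \<Rightarrow> bool" where
  "strongly_envy_free n m A X \<longleftrightarrow>
     (\<forall>i<n. \<forall>j<n. (\<Sum>k<m. A $$ (i, k)) > (\<Sum>k<m. A $$ (j, k)) \<longrightarrow>
                  (\<Sum>k<m. X $$ (i, k)) \<ge> (\<Sum>k<m. X $$ (j, k)))"

end

(* A day on which fewer than the maximal multiple of q available players play can be enlarged
   by q further players; this changes no other entry, so an inefficient solution is never fair
   and it suffices to refute efficiency together with strong envy-freeness.

   For this, take q + 1 players available on exactly the first q + 2 days and q players
   available on exactly the other q + 1 days. In an efficient solution exactly q players play
   each day, so the second group plays q + 1 days each. Strong envy-freeness then forces each
   of the q + 1 players of the first group to play at least q + 1 days, needing (q + 1)^2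
   slots, whereas only q (q + 2) slots exist. *)
theory Submission
  imports Defs
begin

section \<open>Binary matrices and their column counts\<close>

lemma binary_mat_le_1:
  assumes "binary_mat n m X" "i < n" "k < m"
  shows "X $$ (i, k) \<le> 1"
proof -
  have "X $$ (i, k) \<in> elements_mat X"
    using assms unfolding binary_mat_def by (auto intro: elements_matI)
  then show ?thesis
    using assms(1) unfolding binary_mat_def by auto
qed

lemma binary_mat_matI:
  assumes "\<And>i k. i < n \<Longrightarrow> k < m \<Longrightarrow> f (i, k) \<le> (1::nat)"
  shows "binary_mat n m (mat n m f)"
  using assms unfolding binary_mat_def elements_mat_def by (fastforce simp: le_Suc_eq)

lemma binary_mat_col_sum:
  assumes "binary_mat n m X" "k < m"
  shows "(\<Sum>i<n. X $$ (i, k)) = card {i. i < n \<and> X $$ (i, k) \<noteq> 0}"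
proof -
  have "(\<Sum>i<n. X $$ (i, k)) = (\<Sum>i<n. of_bool (X $$ (i, k) \<noteq> 0))"
    using binary_mat_le_1[OF assms(1) _ assms(2)]
    by (intro sum.cong) (fastforce simp: le_Suc_eq)+
  also have "\<dots> = card {i. i < n \<and> X $$ (i, k) \<noteq> 0}"
    by (simp add: sum_of_bool_eq Int_def)
  finally show ?thesis .
qed

lemma card_bool_sum:
  "(\<Sum>i<n::nat. if P i then 1 else (0::nat)) = card {i. i < n \<and> P i}"
  by (subst sum.inter_filter[symmetric]) auto

section \<open>Fairness implies efficiency\<close>

lemma num_playing_at_least_nonpos:
  assumes "p \<le> 0"
  shows "num_playing_at_least n m p X = n"
proof -
  have "{i. i < n \<and> p \<le> int (\<Sum>k<m. X $$ (i, k))} = {..<n}"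
    using assms by (auto intro!: order.trans[OF assms] sum_nonneg)
  then show ?thesis
    unfolding num_playing_at_least_def by simp
qed

text \<open>Raising row sums can only raise each count of players above a threshold, and at player
  \<open>j\<close>'s new total the count rises strictly. So the first threshold at which the counts
  differ favours \<open>Y\<close>.\<close>

lemma fairer_if_row_sums_greater:
  assumes le: "\<And>i. i < n \<Longrightarrow> (\<Sum>k<m. X $$ (i, k)) \<le> (\<Sum>k<m. Y $$ (i, k))"
    and j: "j < n" "(\<Sum>k<m. X $$ (j, k)) < (\<Sum>k<m. Y $$ (j, k))"
  shows "fairer n m Y X"
proof -
  let ?G = "\<lambda>Z p. num_playing_at_least n m p Z"
  let ?s = "\<lambda>Z i. (\<Sum>k<m. Z $$ (i, k))"
  have sub: "{i. i < n \<and> p \<le> int (?s X i)} \<subseteq> {i. i < n \<and> p \<le> int (?s Y i)}" for p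
    using le by (auto intro: order.trans simp del: of_nat_sum)
  have mono: "?G X p \<le> ?G Y p" for p
    unfolding num_playing_at_least_def by (intro card_mono sub) simp
  have "?G X (int (?s Y j)) < ?G Y (int (?s Y j))"
    unfolding num_playing_at_least_def
  proof (rule psubset_card_mono)
    have "j \<in> {i. i < n \<and> int (?s Y j) \<le> int (?s Y i)}"
      and "j \<notin> {i. i < n \<and> int (?s Y j) \<le> int (?s X i)}"
      using j by (auto simp del: of_nat_sum)
    then show "{i. i < n \<and> int (?s Y j) \<le> int (?s X i)}
        \<subset> {i. i < n \<and> int (?s Y j) \<le> int (?s Y i)}"
      using sub by blast
  qed simp
  then have ex: "\<exists>t. ?G X (int t) < ?G Y (int t)" by blast
  \<comment> \<open>Thresholds range over all integers, but at nonpositive ones both counts equal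
    \<open>n\<close>. Hence a least differing threshold exists and can be sought among the
    naturals.\<close>
  define t where "t = (LEAST t. ?G X (int t) < ?G Y (int t))"
  have "?G X (int t) < ?G Y (int t)"
    unfolding t_def using ex by (rule LeastI_ex)
  moreover have "?G Y p = ?G X p" if "p < int t" for p
  proof (cases "p \<le> 0")
    case True
    then show ?thesis by (simp add: num_playing_at_least_nonpos)
  next
    case False
    then obtain u where "p = int u" by (metis nat_0_le linear)
    then show ?thesis
      using that not_less_Least[of u "\<lambda>t. ?G X (int t) < ?G Y (int t)"] mono[of p]
      by (simp add: t_def)
  qed
  ultimately show ?thesis unfolding fairer_def by blast
qed

text \<open>Both sums on day \<open>k\<close> are multiples of \<open>q\<close>, so they differ by
  at least \<open>q\<close>. Hence at least \<open>q\<close> players play that day in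
  \<open>X'\<close> but not in \<open>X\<close>, and adding exactly \<open>q\<close> of them to
  \<open>X\<close> preserves divisibility. On other days \<open>X'\<close> is ignored.\<close>

lemma solution_enlarge:
  assumes X: "solution q n m A X" and X': "solution q n m A X'" and k: "k < m"
    and less: "(\<Sum>i<n. X $$ (i, k)) < (\<Sum>i<n. X' $$ (i, k))"
  obtains Y j where "solution q n m A Y"
    "\<And>i l. i < n \<Longrightarrow> l < m \<Longrightarrow> X $$ (i, l) \<le> Y $$ (i, l)"
    "j < n" "X $$ (j, k) < Y $$ (j, k)"
proof -
  let ?c = "\<lambda>Z k. \<Sum>i<n. Z $$ (i, k)"
  let ?S = "\<lambda>Z. {i. i < n \<and> Z $$ (i, k) \<noteq> 0}"
  have binX: "binary_mat n m X" and binX': "binary_mat n m X'"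
    and dvd: "q dvd ?c X k" "q dvd ?c X' k"
    using X X' k unfolding solution_def by (auto simp: cong_0_iff)
  \<comment> \<open>For \<open>q = 0\<close> divisibility would make both column sums 0, against
    \<open>less\<close>. Positivity makes \<open>T\<close> nonempty, which yields
    \<open>j\<close>.\<close>
  have q: "q > 0" using dvd less by (intro gr0I) auto
  have "q \<le> ?c X' k - ?c X k"
    using dvd less by (intro dvd_imp_le dvd_diff_nat) auto
  also have "\<dots> = card (?S X') - card (?S X)"
    using binary_mat_col_sum[OF binX k] binary_mat_col_sum[OF binX' k] by simp
  also have "\<dots> \<le> card (?S X' - ?S X)"
    by (intro diff_card_le_card_Diff) simp
  finally obtain T where T: "T \<subseteq> ?S X' - ?S X" "card T = q" "finite T"
    by (meson obtain_subset_with_card_n)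
  obtain j where "j \<in> T" using T q by fastforce
  define Y where "Y = mat n m (\<lambda>(i, l). if l = k \<and> i \<in> T then 1 else X $$ (i, l))"
  have Y: "Y $$ (i, l) = (if l = k \<and> i \<in> T then 1 else X $$ (i, l))" if "i < n" "l < m" for i l
    using that by (simp add: Y_def)
  have binY: "binary_mat n m Y"
    unfolding Y_def using binary_mat_le_1[OF binX] by (intro binary_mat_matI) auto
  have "?S Y = ?S X \<union> T"
    using T k by (auto simp: Y split: if_splits)
  moreover have "card (?S X \<union> T) = card (?S X) + card T"
    using T by (intro card_Un_disjoint) auto
  ultimately have "?c Y k = ?c X k + q"
    using binary_mat_col_sum[OF binY k] binary_mat_col_sum[OF binX k] T by simp
  moreover have "?c Y l = ?c X l" if "l < m" "l \<noteq> k" for l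
    using that by (simp add: Y)
  ultimately have "[?c Y l = 0] (mod q)" if "l < m" for l
    using that X dvd unfolding solution_def by (cases "l = k") (auto simp: cong_0_iff)
  \<comment> \<open>Players in \<open>T\<close> are available on day \<open>k\<close> because they
    play then in \<open>X'\<close>.\<close>
  moreover have "Y $$ (i, l) = 0" if "i < n" "l < m" "A $$ (i, l) = 0" for i l
    using that T X X' unfolding solution_def by (auto simp: Y)
  ultimately have "solution q n m A Y"
    using binY unfolding solution_def by blast
  moreover have "X $$ (i, l) \<le> Y $$ (i, l)" if "i < n" "l < m" for i l
    using that T by (auto simp: Y)
  moreover have "j < n" "X $$ (j, k) < Y $$ (j, k)"
    using \<open>j \<in> T\<close> T k by (auto simp: Y)
  ultimately show ?thesis using that by blast
qed

text \<open>A larger total must show on some day. \<open>X'\<close> itself may lower some row sums,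
  so \<open>X\<close> is compared with its enlargement \<open>Y\<close> on that day, which lowers
  none.\<close>

lemma fair_imp_efficient:
  assumes "fair q n m A X"
  shows "efficient q n m A X"
  unfolding efficient_def
proof (intro conjI notI)
  show X: "solution q n m A X" using assms unfolding fair_def by simp
  assume "\<exists>X'. solution q n m A X' \<and>
    (\<Sum>i<n. \<Sum>k<m. X $$ (i, k)) < (\<Sum>i<n. \<Sum>k<m. X' $$ (i, k))"
  then obtain X' where X': "solution q n m A X'"
    and less: "(\<Sum>i<n. \<Sum>k<m. X $$ (i, k)) < (\<Sum>i<n. \<Sum>k<m. X' $$ (i, k))" by blast
  have "(\<Sum>k<m. \<Sum>i<n. X $$ (i, k)) < (\<Sum>k<m. \<Sum>i<n. X' $$ (i, k))"
    using less by (simp add: sum.swap[of _ "{..<m}"])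
  then obtain k where k: "k < m" "(\<Sum>i<n. X $$ (i, k)) < (\<Sum>i<n. X' $$ (i, k))"
    by (meson lessThan_iff not_le sum_mono)
  obtain Y j where Y: "solution q n m A Y"
    "\<And>i l. i < n \<Longrightarrow> l < m \<Longrightarrow> X $$ (i, l) \<le> Y $$ (i, l)"
    "j < n" "X $$ (j, k) < Y $$ (j, k)"
    using solution_enlarge[OF X X' k] by blast
  have "fairer n m Y X"
  proof (rule fairer_if_row_sums_greater)
    show "(\<Sum>k<m. X $$ (i, k)) \<le> (\<Sum>k<m. Y $$ (i, k))" if "i < n" for i
      using that Y by (intro sum_mono) auto
    show "(\<Sum>k<m. X $$ (j, k)) < (\<Sum>k<m. Y $$ (j, k))"
      using Y k by (intro sum_strict_mono_ex1) auto
  qed (fact Y)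
  then show False using assms Y unfolding fair_def by blast
qed

section \<open>The two-group counterexample\<close>

definition two_group_mat :: "nat \<Rightarrow> nat mat" where
  "two_group_mat q =
     mat (2 * q + 1) (2 * q + 3) (\<lambda>(i, k). if (i < q + 1) = (k < q + 2) then 1 else 0)"

text \<open>The defining condition equates two truth values, so the matrix is block diagonal with
  all-ones blocks of size \<open>q + 1\<close> by \<open>q + 2\<close> and \<open>q\<close> by
  \<open>q + 1\<close>. Row sums are block widths.\<close>

lemma two_group_mat_row_sum:
  assumes "i < 2 * q + 1"
  shows "(\<Sum>k<2 * q + 3. two_group_mat q $$ (i, k)) = (if i < q + 1 then q + 2 else q + 1)"
proof -
  have "(\<Sum>k<2 * q + 3. two_group_mat q $$ (i, k))
      = (\<Sum>k<2 * q + 3. if (i < q + 1) = (k < q + 2) then 1 else 0)"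
    using assms by (intro sum.cong) (auto simp: two_group_mat_def)
  also have "\<dots> = card (if i < q + 1 then {..<q + 2} else {q + 2..<2 * q + 3})"
    unfolding card_bool_sum by (rule arg_cong[where f = card]) auto
  finally show ?thesis by simp
qed

lemma two_group_mat_col_sum:
  assumes "k < 2 * q + 3"
  shows "(\<Sum>i<2 * q + 1. two_group_mat q $$ (i, k)) = (if k < q + 2 then q + 1 else q)"
proof -
  have "(\<Sum>i<2 * q + 1. two_group_mat q $$ (i, k))
      = (\<Sum>i<2 * q + 1. if (i < q + 1) = (k < q + 2) then 1 else 0)"
    using assms by (intro sum.cong) (auto simp: two_group_mat_def)
  also have "\<dots> = card (if k < q + 2 then {..<q + 1} else {q + 1..<2 * q + 1})"
    unfolding card_bool_sum by (rule arg_cong[where f = card]) auto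
  finally show ?thesis by simp
qed

lemma sport_problem_two_group_mat:
  "sport_problem q (2 * q + 1) (2 * q + 3) (two_group_mat q)"
  unfolding sport_problem_def
proof (intro conjI allI impI)
  show "binary_mat (2 * q + 1) (2 * q + 3) (two_group_mat q)"
    unfolding two_group_mat_def by (intro binary_mat_matI) auto
qed (simp_all only: two_group_mat_row_sum two_group_mat_col_sum, simp_all)

text \<open>At most \<open>q + 1\<close> players are available on any day, and \<open>q\<close> does
  not divide \<open>q + 1\<close> once \<open>q\<close> \<ge> 2.\<close>

lemma solution_two_group_mat_col_sum_le:
  assumes "q \<ge> 2" "solution q (2 * q + 1) (2 * q + 3) (two_group_mat q) X" "k < 2 * q + 3"
  shows "(\<Sum>i<2 * q + 1. X $$ (i, k)) \<le> q"
proof -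
  have "X $$ (i, k) \<le> two_group_mat q $$ (i, k)" if "i < 2 * q + 1" for i
    using assms that binary_mat_le_1[of "2 * q + 1" "2 * q + 3" X i k]
    unfolding solution_def by (cases "two_group_mat q $$ (i, k) = 0") auto
  then have "(\<Sum>i<2 * q + 1. X $$ (i, k)) \<le> (\<Sum>i<2 * q + 1. two_group_mat q $$ (i, k))"
    by (intro sum_mono) auto
  also have "\<dots> \<le> q + 1"
    using assms(3) by (simp only: two_group_mat_col_sum) simp
  finally have le: "(\<Sum>i<2 * q + 1. X $$ (i, k)) \<le> q + 1" .
  have "q dvd (\<Sum>i<2 * q + 1. X $$ (i, k))"
    using assms unfolding solution_def by (auto simp: cong_0_iff)
  moreover have "\<not> q dvd q + 1" using assms(1) by (simp add: dvd_add_right_iff del: add_Suc_right)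
  ultimately show ?thesis using le by (metis Suc_eq_plus1 le_SucE)
qed

lemma two_group_mat_solution_exists:
  obtains X where "solution q (2 * q + 1) (2 * q + 3) (two_group_mat q) X"
    "(\<Sum>i<2 * q + 1. \<Sum>k<2 * q + 3. X $$ (i, k)) = (2 * q + 3) * q"
proof -
  \<comment> \<open>Player \<open>q\<close>, the last of the first group, always rests; all others
    play whenever available. This leaves exactly \<open>q\<close> players on every day.\<close>
  define X :: "nat mat" where "X = mat (2 * q + 1) (2 * q + 3)
    (\<lambda>(i, k). if i \<noteq> q \<and> (i < q + 1) = (k < q + 2) then 1 else 0)"
  have col: "(\<Sum>i<2 * q + 1. X $$ (i, k)) = q" if "k < 2 * q + 3" for k
  proof -
    have "(\<Sum>i<2 * q + 1. X $$ (i, k))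
        = (\<Sum>i<2 * q + 1. if i \<noteq> q \<and> (i < q + 1) = (k < q + 2) then 1 else 0)"
      using that by (intro sum.cong) (auto simp: X_def)
    also have "\<dots> = card (if k < q + 2 then {..<q} else {q + 1..<2 * q + 1})"
      unfolding card_bool_sum by (rule arg_cong[where f = card]) auto
    finally show ?thesis by simp
  qed
  have "binary_mat (2 * q + 1) (2 * q + 3) X"
    unfolding X_def by (intro binary_mat_matI) auto
  moreover have "X $$ (i, k) = 0"
    if "i < 2 * q + 1" "k < 2 * q + 3" "two_group_mat q $$ (i, k) = 0" for i k
    using that by (simp add: X_def two_group_mat_def split: if_splits)
  moreover have "[(\<Sum>i<2 * q + 1. X $$ (i, k)) = 0] (mod q)" if "k < 2 * q + 3" for k
    unfolding col[OF that] by (simp add: cong_0_iff)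
  ultimately have "solution q (2 * q + 1) (2 * q + 3) (two_group_mat q) X"
    unfolding solution_def by blast
  moreover have "(\<Sum>i<2 * q + 1. \<Sum>k<2 * q + 3. X $$ (i, k)) = (\<Sum>k<2 * q + 3. q)"
    by (subst sum.swap) (rule sum.cong[OF refl], rule col, simp)
  then have "(\<Sum>i<2 * q + 1. \<Sum>k<2 * q + 3. X $$ (i, k)) = (2 * q + 3) * q"
    by simp
  ultimately show ?thesis using that by blast
qed

lemma efficient_two_group_mat_not_strongly_envy_free:
  assumes q: "q \<ge> 2" and eff: "efficient q (2 * q + 1) (2 * q + 3) (two_group_mat q) X"
  shows "\<not> strongly_envy_free (2 * q + 1) (2 * q + 3) (two_group_mat q) X"
proof
  assume envy: "strongly_envy_free (2 * q + 1) (2 * q + 3) (two_group_mat q) X"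
  let ?n = "2 * q + 1" and ?m = "2 * q + 3"
  let ?r = "\<lambda>i. \<Sum>k<?m. X $$ (i, k)"
  have X: "solution q ?n ?m (two_group_mat q) X"
    using eff unfolding efficient_def by simp
  have zero: "X $$ (i, k) = 0" if "i < ?n" "k < ?m" "(i < q + 1) \<noteq> (k < q + 2)" for i k
    using X that unfolding solution_def two_group_mat_def by auto
  \<comment> \<open>The first group plays only on its own \<open>q + 2\<close> days, each with at
    most \<open>q\<close> slots.\<close>
  have "(\<Sum>i<q + 1. ?r i) = (\<Sum>i<q + 1. \<Sum>k<q + 2. X $$ (i, k))"
    by (intro sum.cong sum.mono_neutral_right) (auto intro!: zero)
  also have "\<dots> = (\<Sum>k<q + 2. \<Sum>i<q + 1. X $$ (i, k))"
    by (rule sum.swap)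
  also have "\<dots> \<le> (\<Sum>k<q + 2. \<Sum>i<?n. X $$ (i, k))"
    by (intro sum_mono sum_mono2) auto
  also have "\<dots> \<le> (\<Sum>k<q + 2. q)"
    using solution_two_group_mat_col_sum_le[OF q X] by (intro sum_mono) auto
  finally have first: "(\<Sum>i<q + 1. ?r i) \<le> (q + 2) * q" by simp
  \<comment> \<open>Efficiency is tested against the solution filling \<open>q\<close> slots daily;
    subtracting \<open>first\<close> bounds the second group's share from below.\<close>
  have "(2 * q + 3) * q \<le> (\<Sum>i<?n. ?r i)"
    using eff two_group_mat_solution_exists[of q] unfolding efficient_def
    by (metis not_le)
  also have "(\<Sum>i<?n. ?r i) = (\<Sum>i<q + 1. ?r i) + (\<Sum>i=q + 1..<?n. ?r i)"
    unfolding lessThan_atLeast0 by (rule sum.atLeastLessThan_concat[symmetric]) auto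
  finally have second: "(q + 1) * q \<le> (\<Sum>i=q + 1..<?n. ?r i)"
    using first by (simp add: algebra_simps del: sum.lessThan_Suc)
  \<comment> \<open>Pigeonhole: \<open>q\<close> players share at least \<open>(q + 1) * q\<close>
    slots. One such player suffices for the envy argument.\<close>
  have "\<exists>j\<in>{q + 1..<?n}. q + 1 \<le> ?r j"
  proof (rule ccontr)
    assume "\<not> ?thesis"
    then have "(\<Sum>i=q + 1..<?n. ?r i) \<le> (\<Sum>i=q + 1..<?n. q)"
      by (intro sum_mono) (simp add: not_le less_Suc_eq_le)
    then show False using second q by simp
  qed
  then obtain j where j: "j < ?n" "\<not> j < q + 1" "q + 1 \<le> ?r j" by auto
  have "q + 1 \<le> ?r i" if "i < q + 1" for i
  proof -
    have "(\<Sum>k<?m. two_group_mat q $$ (j, k)) < (\<Sum>k<?m. two_group_mat q $$ (i, k))"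
      using that j by (subst (1 2) two_group_mat_row_sum) auto
    then have "?r j \<le> ?r i"
      using envy that j unfolding strongly_envy_free_def by simp
    then show ?thesis using j by simp
  qed
  \<comment> \<open>The contradiction is tight: \<open>(q + 1) * (q + 1)\<close> exceeds
    \<open>(q + 2) * q\<close> by exactly 1.\<close>
  then have "(\<Sum>i<q + 1. q + 1) \<le> (\<Sum>i<q + 1. ?r i)"
    by (intro sum_mono) auto
  then show False using first by simp
qed

theorem theorem1:
  fixes q :: nat
  assumes "q \<ge> 2"
  shows "\<exists>n m A. n > 0 \<and> m > 0 \<and> sport_problem q n m A \<and>
           \<not> (\<exists>X. solution q n m A X \<and> efficient q n m A X \<and> strongly_envy_free n m A X) \<and>
           \<not> (\<exists>X. solution q n m A X \<and> fair q n m A X \<and> strongly_envy_free n m A X)"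
proof (intro exI conjI)
  \<comment> \<open>This goal fixes the witnesses for \<open>n\<close>, \<open>m\<close> and
    \<open>A\<close>; the fair case then reduces to the efficient one.\<close>
  show "sport_problem q (2 * q + 1) (2 * q + 3) (two_group_mat q)"
    by (rule sport_problem_two_group_mat)
qed (use efficient_two_group_mat_not_strongly_envy_free[OF assms] fair_imp_efficient
    in \<open>simp, simp, blast+\<close>)

end
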